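(* Let $\bm F\in\mathbb R^{n\times m}$ and $Z\subseteq\{0,1\}^n$. For $\bm c,\bm d\in\mathbb R^n$ consider $$(P)\qquad \min\{\bm d^\top\bm x+\bm c^\top\bm z+\|\bm F^\top\bm x\|_2^2:\ \bm x\in\mathbb R^n,\ \bm z\in Z,\ \bm x\circ(\bm 1-\bm z)=\bm 0\}.$$ Assume that, for all $\bm c,\bm d\in\mathbb R^n$, $(P)$ is not unbounded if and only if there exists $\bm\delta\in\mathbb R^m$ with $\bm F\bm\delta=\bm d$. Let $\mathcal D=(N,A,\bm\nu,\bm u)$ be the exact decision diagram for $\bm F$ and $Z$ defined in the context, let $\bm c,\bm d\in\mathbb R^n$ be such that $(P)$ is not unbounded, and let $\bm\delta\in\mathbb R^m$ satisfy $\bm F\bm\delta=\bm d$. Define the length of each arc $a\in A$ as $$l_a=c_{\ell(a)}\nu_a-\tfrac14(\bm\delta^\top\bm u_a)^2 .$$ Then for any path of arcs $(a_1,\dots,a_{\ell-1})$ starting at the root, the total length equals $g^\ell(\bm v)$, where $\bm v\in\{0,1\}^{\ell-1}$ is given by $v_i=\nu_{a_i}$ and $$g^\ell(\bm v)=\sum_{i=1}^{\ell-1}c_iv_i+\min_{\bm y\in\mathrm{Row}(\bm F_{\bm v})}\ \bm\delta^\top\bm y+\|\bm y\|_2^2 .$$ In particular, any shortest path $(a_1,\dots,a_n)$ from the root to a node of the last layer corresponds to an optimal solution of $(P)$: there is $\bm x$ such that $(\bm x,\bm z)$ with $\bm z=(\nu_{a_1},\dots,\nu_{a_n})$ is optimal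 for $(P)$.
   Context: $\circ$ is the entrywise product; $\bm H_\downarrow$ is $\bm H$ with its first row deleted. For $\bm v\in\{0,1\}^{\ell-1}$, $\bm F_{\bm v}$ is the submatrix of $\bm F$ consisting of the rows $i\in\{1,\dots,\ell-1\}$ with $v_i=1$; $\mathrm{Row}(\cdot)$ is the row space ($\{\bm 0\}\subset\mathbb R^m$ if there are no rows). By convention $g^1=0$. Completion sets. For $\bm v\in\{0,1\}^{\ell-1}$, $Z^\ell(\bm v)=\{\bm w\in\{0,1\}^{n+1-\ell}:(\bm v,\bm w)\in Z\}$. Dynamic programming representation of $Z$ (assumed given). Every partial solution $\bm v\in\{0,1\}^{\ell-1}$ with $Z^\ell(\bm v)\ne\emptyset$ has a state $\rho^\ell(\bm v)$ such that partial solutions with the same state have the same completion set, and there is an update function $\psi$ with $\rho^{\ell+1}((\bm v,\bar z))=\psi(\rho^\ell(\bm v),\bar z)$. A decision $\bar z\in\{0,1\}$ at a state $\rho^\ell(\bm v)$ is infeasible if $Z^{\ell+1}((\bm v,\bar z))=\emptyset$. Exact decision diagram. It is a layered directed multigraph with layers $1,\dots,n+1$. Layer 1 contains only the root state $s^1=(\rho^1,\bm F)$. A node of layer $\ell$ is a state $(\rho,\bm H)$ with $\bm H\in\mathbb R^{(n+1-\ell)\times m}$; identical states in the same layer are the same node. For each node $(\rho,\bm H)$ of layer $\ell\le n$ and each feasible decision $\bar z\in\{0,1\}$ there is one arc $a$ with tail $(\rho,\bm H)$, layer $\ell(a)=\ell$, value $\nu_a=\bar z$, and, where $\bm u^\top$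 denotes the first row of $\bm H$: - if $\bar z=0$, or $\bar z=1$ and $\bm u=\bm 0$: head $(\psi(\rho,\bar z),\bm H_\downarrow)$ and transition vector $\bm u_a=\bm 0$; - if $\bar z=1$ and $\bm u\ne\bm 0$: head $(\psi(\rho,\bar z),\bm H_\downarrow(\bm I-\bm u\bm u^\top/\|\bm u\|_2^2))$ and transition vector $\bm u_a=\bm u/\|\bm u\|_2$. Infeasible decisions generate no arcs. $N$ and $A$ are the nodes and arcs generated from the root. *)

theory Defs
  imports
    Complex_Main
    "Jordan_Normal_Form.Matrix"
    "Jordan_Normal_Form.VS_Connect"
    "Jordan_Normal_Form.DL_Submatrix"
begin

text \<open>
  Vectors and matrices are those of \<^theory>\<open>Jordan_Normal_Form.Matrix\<close>. Layers are numbered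
  \<open>1, \<dots>, n + 1\<close>, whereas vector and matrix indices start at \<open>0\<close>. The coordinate belonging to
  layer \<open>l\<close> is therefore the one with index \<open>l - 1\<close>.
\<close>

definition norm2 :: "real vec \<Rightarrow> real" where
  "norm2 v = sqrt (v \<bullet> v)"

definition hadamard :: "real vec \<Rightarrow> real vec \<Rightarrow> real vec" (infixl \<open>\<circ>\<^sub>v\<close> 70) where
  "x \<circ>\<^sub>v y = vec (dim_vec x) (\<lambda>i. x $ i * y $ i)"

definition ones_vec :: "nat \<Rightarrow> real vec" where
  "ones_vec n = vec n (\<lambda>_. 1)"

definition outer_prod :: "real vec \<Rightarrow> real vec \<Rightarrow> real mat" where
  "outer_prod u v = mat (dim_vec u) (dim_vec v) (\<lambda>(i, j). u $ i * v $ j)"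

definition delete_first_row :: "real mat \<Rightarrow> real mat" where
  "delete_first_row H = mat (dim_row H - 1) (dim_col H) (\<lambda>(i, j). H $$ (i + 1, j))"

definition bin_vecs :: "nat \<Rightarrow> real vec set" where
  "bin_vecs k = {v \<in> carrier_vec k. \<forall>i<k. v $ i \<in> {0, 1}}"


subsection \<open>The optimization problem\<close>

definition feasible_set :: "nat \<Rightarrow> real vec set \<Rightarrow> (real vec \<times> real vec) set" where
  "feasible_set n Z =
     {(x, z). x \<in> carrier_vec n \<and> z \<in> Z \<and> x \<circ>\<^sub>v (ones_vec n - z) = 0\<^sub>v n}"

definition objective :: "real mat \<Rightarrow> real vec \<Rightarrow> real vec \<Rightarrow> real vec \<times> real vec \<Rightarrow> real" where
  "objective F c d = (\<lambda>(x, z). d \<bullet> x + c \<bullet> z + (norm2 (F\<^sup>T *\<^sub>v x))\<^sup>2)"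

definition unbounded_problem ::
    "nat \<Rightarrow> real mat \<Rightarrow> real vec set \<Rightarrow> real vec \<Rightarrow> real vec \<Rightarrow> bool" where
  "unbounded_problem n F Z c d \<longleftrightarrow> (\<forall>B. \<exists>p\<in>feasible_set n Z. objective F c d p < B)"

definition optimal_solution ::
    "nat \<Rightarrow> real mat \<Rightarrow> real vec set \<Rightarrow> real vec \<Rightarrow> real vec \<Rightarrow> real vec \<times> real vec \<Rightarrow> bool" where
  "optimal_solution n F Z c d p \<longleftrightarrow>
     is_arg_min (objective F c d) (\<lambda>q. q \<in> feasible_set n Z) p"


subsection \<open>The dynamic programming representation\<close>

definition append_decision :: "real vec \<Rightarrow> real \<Rightarrow> real vec" where
  "append_decision v b = v @\<^sub>v vec_of_list [b]"

definition completions :: "nat \<Rightarrow> real vec set \<Rightarrow> nat \<Rightarrow> real vec \<Rightarrow> real vec set" where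
  "completions n Z l v = {w \<in> bin_vecs (n + 1 - l). v @\<^sub>v w \<in> Z}"

text \<open>The partial solutions that possess a state:\<close>

definition partial_sols :: "nat \<Rightarrow> real vec set \<Rightarrow> nat \<Rightarrow> real vec set" where
  "partial_sols n Z l = {v \<in> bin_vecs (l - 1). completions n Z l v \<noteq> {}}"

text \<open>
  The function \<open>\<rho> l\<close> matters only on \<^term>\<open>partial_sols n Z l\<close>. Accordingly the recursion is
  required only when the extended partial solution has a completion.
\<close>

definition dp_representation ::
    "nat \<Rightarrow> real vec set \<Rightarrow> (nat \<Rightarrow> real vec \<Rightarrow> 's) \<Rightarrow> ('s \<Rightarrow> real \<Rightarrow> 's) \<Rightarrow> bool" where
  "dp_representation n Z \<rho> \<psi> \<longleftrightarrow>
     (\<forall>l\<in>{1..n + 1}. \<forall>v\<in>partial_sols n Z l. \<forall>v'\<in>partial_sols n Z l.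
        \<rho> l v = \<rho> l v' \<longrightarrow> completions n Z l v = completions n Z l v') \<and>
     (\<forall>l\<in>{1..n}. \<forall>v\<in>partial_sols n Z l. \<forall>b\<in>{0, 1}.
        append_decision v b \<in> partial_sols n Z (l + 1) \<longrightarrow>
          \<rho> (l + 1) (append_decision v b) = \<psi> (\<rho> l v) b)"

text \<open>
  Feasibility of a decision at the state \<open>r\<close> of layer \<open>l\<close>. In a dynamic programming representation
  it does not depend on which partial solution \<open>v\<close> with state \<open>r\<close> is used.
\<close>

definition feasible_decision ::
    "nat \<Rightarrow> real vec set \<Rightarrow> (nat \<Rightarrow> real vec \<Rightarrow> 's) \<Rightarrow> nat \<Rightarrow> 's \<Rightarrow> real \<Rightarrow> bool" where
  "feasible_decision n Z \<rho> l r b \<longleftrightarrow>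
     b \<in> {0, 1} \<and>
     (\<exists>v\<in>partial_sols n Z l. \<rho> l v = r \<and> completions n Z (l + 1) (append_decision v b) \<noteq> {})"


subsection \<open>The exact decision diagram\<close>

text \<open>A node is a triple \<open>(l, r, H)\<close>: the state \<open>(r, H)\<close> in layer \<open>l\<close>.\<close>

type_synonym 's node = "nat \<times> 's \<times> real mat"

record 's arc =
  arc_tail :: "'s node"
  arc_head :: "'s node"
  arc_value :: real
  arc_trans :: "real vec"

definition arc_layer :: "'s arc \<Rightarrow> nat" where
  "arc_layer a = fst (arc_tail a)"

definition next_matrix :: "real mat \<Rightarrow> real \<Rightarrow> real mat" where
  "next_matrix H b =
     (let u = row H 0; m = dim_col H in
      if b = 1 \<and> u \<noteq> 0\<^sub>v m
      then delete_first_row H * (1\<^sub>m m - (1 / (norm2 u)\<^sup>2) \<cdot>\<^sub>m outer_prod u u)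
      else delete_first_row H)"

definition transition_vec :: "real mat \<Rightarrow> real \<Rightarrow> real vec" where
  "transition_vec H b =
     (let u = row H 0; m = dim_col H in
      if b = 1 \<and> u \<noteq> 0\<^sub>v m then (1 / norm2 u) \<cdot>\<^sub>v u else 0\<^sub>v m)"

fun dd_arc :: "('s \<Rightarrow> real \<Rightarrow> 's) \<Rightarrow> 's node \<Rightarrow> real \<Rightarrow> 's arc" where
  "dd_arc \<psi> (l, r, H) b =
     \<lparr> arc_tail = (l, r, H),
       arc_head = (l + 1, \<psi> r b, next_matrix H b),
       arc_value = b,
       arc_trans = transition_vec H b \<rparr>"

definition dd_root :: "(nat \<Rightarrow> real vec \<Rightarrow> 's) \<Rightarrow> real mat \<Rightarrow> 's node" where
  "dd_root \<rho> F = (1, \<rho> 1 vNil, F)"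

inductive_set dd_nodes ::
    "nat \<Rightarrow> real vec set \<Rightarrow> (nat \<Rightarrow> real vec \<Rightarrow> 's) \<Rightarrow> ('s \<Rightarrow> real \<Rightarrow> 's) \<Rightarrow> real mat \<Rightarrow> 's node set"
  for n Z \<rho> \<psi> F where
  root: "dd_root \<rho> F \<in> dd_nodes n Z \<rho> \<psi> F"
| step: "(l, r, H) \<in> dd_nodes n Z \<rho> \<psi> F \<Longrightarrow> l \<le> n \<Longrightarrow> feasible_decision n Z \<rho> l r b \<Longrightarrow>
         arc_head (dd_arc \<psi> (l, r, H) b) \<in> dd_nodes n Z \<rho> \<psi> F"

text \<open>
  Arcs form a set although the diagram is a multigraph: parallel arcs have different values.
\<close>

definition dd_arcs ::
    "nat \<Rightarrow> real vec set \<Rightarrow> (nat \<Rightarrow> real vec \<Rightarrow> 's) \<Rightarrow> ('s \<Rightarrow> real \<Rightarrow> 's) \<Rightarrow> real mat \<Rightarrow> 's arc set"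
  where
  "dd_arcs n Z \<rho> \<psi> F =
     {dd_arc \<psi> (l, r, H) b | l r H b.
        (l, r, H) \<in> dd_nodes n Z \<rho> \<psi> F \<and> l \<le> n \<and> feasible_decision n Z \<rho> l r b}"

text \<open>\<open>dd_path A s as t\<close>: the arcs \<open>as\<close>, all taken from \<open>A\<close>, lead from \<open>s\<close> to \<open>t\<close>.\<close>

fun dd_path :: "'s arc set \<Rightarrow> 's node \<Rightarrow> 's arc list \<Rightarrow> 's node \<Rightarrow> bool" where
  "dd_path A s [] t \<longleftrightarrow> s = t"
| "dd_path A s (a # as) t \<longleftrightarrow> a \<in> A \<and> arc_tail a = s \<and> dd_path A (arc_head a) as t"

definition path_vec :: "'s arc list \<Rightarrow> real vec" where
  "path_vec as = vec_of_list (map arc_value as)"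

definition arc_length :: "real vec \<Rightarrow> real vec \<Rightarrow> 's arc \<Rightarrow> real" where
  "arc_length c \<delta> a = c $ (arc_layer a - 1) * arc_value a - 1 / 4 * (\<delta> \<bullet> arc_trans a)\<^sup>2"

definition path_length :: "real vec \<Rightarrow> real vec \<Rightarrow> 's arc list \<Rightarrow> real" where
  "path_length c \<delta> as = (\<Sum>a\<leftarrow>as. arc_length c \<delta> a)"

text \<open>
  Shortest among all paths from the root to the last layer, which may consist of several nodes.
\<close>

definition shortest_root_path ::
    "nat \<Rightarrow> real vec set \<Rightarrow> (nat \<Rightarrow> real vec \<Rightarrow> 's) \<Rightarrow> ('s \<Rightarrow> real \<Rightarrow> 's) \<Rightarrow> real mat \<Rightarrow>
     real vec \<Rightarrow> real vec \<Rightarrow> 's arc list \<Rightarrow> bool" where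
  "shortest_root_path n Z \<rho> \<psi> F c \<delta> as \<longleftrightarrow>
     is_arg_min (path_length c \<delta>)
       (\<lambda>bs. \<exists>t\<in>dd_nodes n Z \<rho> \<psi> F.
          fst t = n + 1 \<and> dd_path (dd_arcs n Z \<rho> \<psi> F) (dd_root \<rho> F) bs t)
       as"


subsection \<open>The values of partial solutions\<close>

definition selected_rows :: "real mat \<Rightarrow> nat \<Rightarrow> real vec \<Rightarrow> real mat" where
  "selected_rows F l v = submatrix F {i. i < l - 1 \<and> v $ i = 1} UNIV"

definition Row :: "real mat \<Rightarrow> real vec set" where
  "Row A = vec_space.row_space (dim_col A) A"

definition row_objective :: "real vec \<Rightarrow> real vec \<Rightarrow> real" where
  "row_objective \<delta> y = \<delta> \<bullet> y + (norm2 y)\<^sup>2"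

text \<open>
  An infimum of reals is meaningful as a minimum only if it is attained, so attainment has to be
  claimed wherever \<open>partial_value\<close> is used.
\<close>

definition partial_value ::
    "real mat \<Rightarrow> real vec \<Rightarrow> real vec \<Rightarrow> nat \<Rightarrow> real vec \<Rightarrow> real" where
  "partial_value F c \<delta> l v =
     (\<Sum>i<l - 1. c $ i * v $ i) + (INF y\<in>Row (selected_rows F l v). row_objective \<delta> y)"

text \<open>The convention that the value in the first layer is \<open>0\<close> needs no separate case:\<close>

lemma partial_value_1: "partial_value F c \<delta> 1 v = 0"
proof -
  have rows: "rows (selected_rows F 1 v) = []"
    by (simp add: rows_def selected_rows_def dim_submatrix)
  interpret vec_space "TYPE(real)" "dim_col F" .
  have "dim_col (selected_rows F 1 v) = dim_col F"
    by (simp add: selected_rows_def dim_submatrix)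
  then have "Row (selected_rows F 1 v) = span (set (rows (selected_rows F 1 v)))"
    by (simp add: Row_def row_space_def)
  also have "\<dots> = {0\<^sub>v (dim_col F)}"
    unfolding rows by (simp add: span_empty)
  finally show ?thesis
    by (simp add: partial_value_def row_objective_def norm2_def scalar_prod_def)
qed

end

theory Submission
  imports Defs
begin

text \<open>
  Along a path the state matrix carries the remaining rows of \<open>F\<close>, projected onto the orthogonal
  complement of the span of the rows selected so far. Selecting a row with projection \<open>u \<noteq> 0\<close>
  therefore adds to the row space a direction orthogonal to it, so the minimum changes by
  \<open>min\<^sub>t t (\<delta> \<bullet> u) + t\<^sup>2 (u \<bullet> u) = - (\<delta> \<bullet> u)\<^sup>2 / (4 (u \<bullet> u))\<close>, which is the arc length without its
  linear part; if \<open>u = 0\<close>, nothing changes. Substituting \<open>y = F\<^sup>T x\<close> turns the objective of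
  \<open>(P)\<close> into that of the value function, since \<open>d \<bullet> x = \<delta> \<bullet> F\<^sup>T x\<close>, and the paths to the last
  layer are exactly the elements of \<open>Z\<close>.
\<close>

subsection \<open>Row spaces of submatrices\<close>

text \<open>\<open>pick I\<close> enumerates \<open>I\<close> in increasing order, so its inverse
  maps an element to its rank, the number of smaller elements. This turns sums over the rows of a
  submatrix into sums over the chosen row indices.\<close>

lemma bij_betw_pick: "bij_betw (pick I) {..<card I} I" if "finite I"
proof (rule bij_betw_byWitness[where f' = "\<lambda>i. card {a \<in> I. a < i}"])
  show "\<forall>j\<in>{..<card I}. card {a \<in> I. a < pick I j} = j"
    using card_pick_le by blast
  show "\<forall>i\<in>I. pick I (card {a \<in> I. a < i}) = i"
    by (simp add: pick_card_in_set)
  show "pick I ` {..<card I} \<subseteq> I"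
    using pick_in_set_le by blast
  show "(\<lambda>i. card {a \<in> I. a < i}) ` I \<subseteq> {..<card I}"
    using that by (auto intro!: psubset_card_mono)
qed

text \<open>The span of the rows with index in \<open>I\<close>, written with coefficient vectors
  over all rows that vanish outside \<open>I\<close>. The selected rows keep their numbers, and the
  condition on \<open>x\<close> is the one that the problem imposes on feasible points.\<close>

definition rows_span :: "real mat \<Rightarrow> nat set \<Rightarrow> real vec set" where
  "rows_span F I =
     {F\<^sup>T *\<^sub>v x | x. x \<in> carrier_vec (dim_row F) \<and> (\<forall>i<dim_row F. i \<notin> I \<longrightarrow> x $ i = 0)}"

lemma rows_spanI:
  assumes "x \<in> carrier_vec (dim_row F)" "\<And>i. i < dim_row F \<Longrightarrow> i \<notin> I \<Longrightarrow> x $ i = 0"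
  shows "F\<^sup>T *\<^sub>v x \<in> rows_span F I"
  using assms unfolding rows_span_def by auto

lemma rows_spanE:
  assumes "y \<in> rows_span F I"
  obtains x where "y = F\<^sup>T *\<^sub>v x" "x \<in> carrier_vec (dim_row F)"
    "\<And>i. i < dim_row F \<Longrightarrow> i \<notin> I \<Longrightarrow> x $ i = 0"
  using assms unfolding rows_span_def by auto

text \<open>The submatrix renumbers its rows by \<open>pick\<close>. Compressing a coefficient
  vector to the selected positions, or padding it with zeros, translates between the two
  descriptions.\<close>

lemma Row_submatrix: "Row (submatrix F I UNIV) = rows_span F I"
proof -
  define n m where "n = dim_row F" and "m = dim_col F"
  define J where "J = {i. i < n \<and> i \<in> I}"
  define S where "S = submatrix F I UNIV"
  have F: "F \<in> carrier_mat n m"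
    unfolding n_def m_def by auto
  have finJ: "finite J"
    unfolding J_def by auto
  have S: "S \<in> carrier_mat (card J) m"
    unfolding S_def J_def n_def m_def by (intro carrier_matI) (simp_all add: dim_submatrix)
  have bij: "bij_betw (pick J) {..<card J} J"
    using bij_betw_pick[OF finJ] .
  \<comment> \<open>\<open>submatrix_index\<close> is phrased with \<open>pick I\<close>, where
    \<open>I\<close> may exceed the row range or be infinite; \<open>pick_reduce_set\<close>
    replaces \<open>I\<close> by its finite part \<open>J\<close>. On the columns,
    \<open>pick UNIV\<close> is the identity.\<close>
  have Sidx: "S $$ (i, j) = F $$ (pick J i, j)" if "i < card J" "j < m" for i j
    using submatrix_index[of i F I j UNIV] pick_reduce_set[of i n I] that
    by (simp add: S_def J_def n_def m_def pick_UNIV)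
  \<comment> \<open>Both inclusions rest on this: \<open>y\<close> lists the entries of
    \<open>x\<close> on \<open>J\<close> in increasing order, and the entries of \<open>x\<close>
    outside \<open>J\<close> contribute nothing.\<close>
  have eq: "S\<^sup>T *\<^sub>v y = F\<^sup>T *\<^sub>v x"
    if y: "y \<in> carrier_vec (card J)" and x: "x \<in> carrier_vec n"
      and x0: "\<And>i. i < n \<Longrightarrow> i \<notin> J \<Longrightarrow> x $ i = 0"
      and xy: "\<And>j. j < card J \<Longrightarrow> y $ j = x $ pick J j" for x y
  proof (rule eq_vecI)
    fix j assume "j < dim_vec (F\<^sup>T *\<^sub>v x)"
    then have j: "j < m"
      using F by simp
    have "(S\<^sup>T *\<^sub>v y) $ j = (\<Sum>i<card J. S $$ (i, j) * y $ i)"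
      using S y j by (auto simp: scalar_prod_def lessThan_atLeast0)
    also have "\<dots> = (\<Sum>i<card J. F $$ (pick J i, j) * x $ pick J i)"
      using Sidx j xy by simp
    also have "\<dots> = (\<Sum>i\<in>J. F $$ (i, j) * x $ i)"
      using sum.reindex_bij_betw[OF bij, of "\<lambda>i. F $$ (i, j) * x $ i"] .
    also have "\<dots> = (\<Sum>i<n. F $$ (i, j) * x $ i)"
      by (rule sum.mono_neutral_left) (use x0 in \<open>auto simp: J_def\<close>)
    also have "\<dots> = (F\<^sup>T *\<^sub>v x) $ j"
      using F x j by (auto simp: scalar_prod_def lessThan_atLeast0)
    finally show "(S\<^sup>T *\<^sub>v y) $ j = (F\<^sup>T *\<^sub>v x) $ j" .
  qed (use S F in auto)
  have Row: "Row S = {w \<in> carrier_vec m. \<exists>y\<in>carrier_vec (card J). S\<^sup>T *\<^sub>v y = w}"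
    using S vec_space.row_space_eq[of S "card J" m] unfolding Row_def by simp
  have "Row S \<subseteq> rows_span F I"
  proof
    fix w assume "w \<in> Row S"
    then obtain y where y: "y \<in> carrier_vec (card J)" "w = S\<^sup>T *\<^sub>v y"
      unfolding Row by auto
    \<comment> \<open>Zero padding: an index in \<open>J\<close> receives the entry of
      \<open>y\<close> at its rank in \<open>J\<close>.\<close>
    define x where "x = vec n (\<lambda>i. if i \<in> J then y $ card {a \<in> J. a < i} else 0)"
    have "w = F\<^sup>T *\<^sub>v x"
      unfolding y(2)
    proof (rule eq)
      fix j assume j: "j < card J"
      then have "pick J j \<in> J"
        by (rule pick_in_set_le)
      then show "y $ j = x $ pick J j"
        using j card_pick_le[OF j] by (auto simp: x_def J_def)
    qed (use y in \<open>auto simp: x_def\<close>)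
    then show "w \<in> rows_span F I"
      by (auto simp: x_def n_def J_def intro!: rows_spanI)
  qed
  moreover have "rows_span F I \<subseteq> Row S"
  proof
    fix w assume "w \<in> rows_span F I"
    then obtain x where x: "w = F\<^sup>T *\<^sub>v x" "x \<in> carrier_vec n"
        "\<And>i. i < n \<Longrightarrow> i \<notin> I \<Longrightarrow> x $ i = 0"
      unfolding n_def by (elim rows_spanE) blast
    define y where "y = vec (card J) (\<lambda>j. x $ pick J j)"
    have "S\<^sup>T *\<^sub>v y = w"
      unfolding x(1) by (rule eq) (use x in \<open>auto simp: J_def y_def\<close>)
    moreover have "y \<in> carrier_vec (card J)"
      by (simp add: y_def)
    moreover have "w \<in> carrier_vec m"
      using x F by auto
    ultimately show "w \<in> Row S"
      unfolding Row by (intro CollectI conjI bexI)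
  qed
  ultimately show ?thesis
    unfolding S_def by (rule subset_antisym)
qed

lemma rows_span_carrier: "y \<in> rows_span F I \<Longrightarrow> y \<in> carrier_vec (dim_col F)"
  unfolding rows_span_def by (auto intro!: carrier_vecI)

lemma rows_span_add:
  assumes "y \<in> rows_span F I" "y' \<in> rows_span F I"
  shows "y + y' \<in> rows_span F I"
proof -
  obtain x x' where x: "y = F\<^sup>T *\<^sub>v x" "x \<in> carrier_vec (dim_row F)"
      "\<And>i. i < dim_row F \<Longrightarrow> i \<notin> I \<Longrightarrow> x $ i = 0"
    and x': "y' = F\<^sup>T *\<^sub>v x'" "x' \<in> carrier_vec (dim_row F)"
      "\<And>i. i < dim_row F \<Longrightarrow> i \<notin> I \<Longrightarrow> x' $ i = 0"
    using assms by (elim rows_spanE) blast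
  have "F\<^sup>T *\<^sub>v (x + x') \<in> rows_span F I"
    using x x' by (intro rows_spanI) auto
  moreover have "F\<^sup>T *\<^sub>v (x + x') = y + y'"
    unfolding x x' using x x' by (intro mult_add_distrib_mat_vec) auto
  ultimately show ?thesis
    by simp
qed

lemma rows_span_smult:
  assumes "y \<in> rows_span F I"
  shows "t \<cdot>\<^sub>v y \<in> rows_span F I"
proof -
  obtain x where x: "y = F\<^sup>T *\<^sub>v x" "x \<in> carrier_vec (dim_row F)"
      "\<And>i. i < dim_row F \<Longrightarrow> i \<notin> I \<Longrightarrow> x $ i = 0"
    using assms by (elim rows_spanE) blast
  have "F\<^sup>T *\<^sub>v (t \<cdot>\<^sub>v x) \<in> rows_span F I"
    using x by (intro rows_spanI) auto
  moreover have "F\<^sup>T *\<^sub>v (t \<cdot>\<^sub>v x) = t \<cdot>\<^sub>v y"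
    unfolding x using x by (intro mult_mat_vec) auto
  ultimately show ?thesis
    by simp
qed

lemma rows_span_mono: "I \<subseteq> J \<Longrightarrow> rows_span F I \<subseteq> rows_span F J"
  unfolding rows_span_def by blast

lemma zero_in_rows_span: "0\<^sub>v (dim_col F) \<in> rows_span F I"
proof -
  have "F\<^sup>T *\<^sub>v 0\<^sub>v (dim_row F) \<in> rows_span F I"
    by (rule rows_spanI) auto
  moreover have "F\<^sup>T *\<^sub>v 0\<^sub>v (dim_row F) = 0\<^sub>v (dim_col F)"
    by (rule eq_vecI) auto
  ultimately show ?thesis
    by simp
qed

lemma rows_span_empty: "rows_span F {} = {0\<^sub>v (dim_col F)}"
proof -
  have "y = 0\<^sub>v (dim_col F)" if y: "y \<in> rows_span F {}" for y
  proof -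
    obtain x where x: "y = F\<^sup>T *\<^sub>v x" "x \<in> carrier_vec (dim_row F)"
        "\<And>i. i < dim_row F \<Longrightarrow> x $ i = 0"
      using y by (auto elim: rows_spanE)
    show ?thesis
      unfolding x(1) by (rule eq_vecI) (use x in \<open>auto simp: scalar_prod_def\<close>)
  qed
  then show ?thesis
    using zero_in_rows_span by blast
qed

lemma row_in_rows_span:
  assumes "k < dim_row F" "k \<in> I"
  shows "row F k \<in> rows_span F I"
proof -
  have "F\<^sup>T *\<^sub>v unit_vec (dim_row F) k \<in> rows_span F I"
    using assms by (intro rows_spanI) auto
  moreover have "F\<^sup>T *\<^sub>v unit_vec (dim_row F) k = row F k"
    by (rule eq_vecI) (use assms in auto)
  ultimately show ?thesis
    by simp
qed

text \<open>Splitting the coefficient of row \<open>k\<close> off the coefficient vector leaves one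
  that vanishes outside \<open>I\<close>.\<close>

lemma rows_span_insertE:
  assumes "y \<in> rows_span F (insert k I)" "k < dim_row F"
  obtains y' t where "y' \<in> rows_span F I" "y = y' + t \<cdot>\<^sub>v row F k"
proof -
  obtain x where x: "y = F\<^sup>T *\<^sub>v x" "x \<in> carrier_vec (dim_row F)"
      "\<And>i. i < dim_row F \<Longrightarrow> i \<notin> insert k I \<Longrightarrow> x $ i = 0"
    using assms(1) by (elim rows_spanE) blast
  define x' where "x' = vec (dim_row F) (\<lambda>i. if i = k then 0 else x $ i)"
  have "x = x' + x $ k \<cdot>\<^sub>v unit_vec (dim_row F) k"
    by (rule eq_vecI) (use x assms(2) in \<open>auto simp: x'_def\<close>)
  then have "y = F\<^sup>T *\<^sub>v (x' + x $ k \<cdot>\<^sub>v unit_vec (dim_row F) k)"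
    using x(1) by simp
  also have "\<dots> = F\<^sup>T *\<^sub>v x' + F\<^sup>T *\<^sub>v (x $ k \<cdot>\<^sub>v unit_vec (dim_row F) k)"
    by (rule mult_add_distrib_mat_vec) (auto simp: x'_def)
  also have "F\<^sup>T *\<^sub>v (x $ k \<cdot>\<^sub>v unit_vec (dim_row F) k) = x $ k \<cdot>\<^sub>v (F\<^sup>T *\<^sub>v unit_vec (dim_row F) k)"
    by (rule mult_mat_vec) auto
  also have "F\<^sup>T *\<^sub>v unit_vec (dim_row F) k = row F k"
    by (rule eq_vecI) (use assms in auto)
  finally have "y = F\<^sup>T *\<^sub>v x' + x $ k \<cdot>\<^sub>v row F k" .
  moreover have "F\<^sup>T *\<^sub>v x' \<in> rows_span F I"
    by (rule rows_spanI) (use x in \<open>auto simp: x'_def\<close>)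
  ultimately show ?thesis
    using that by blast
qed

text \<open>Row \<open>k\<close> and its residual \<open>u\<close> differ by an element of the span,
  so both extend it to the same space. The enlarged span is thereby parametrized by the old one and
  a multiple of \<open>u\<close>; where the lemma is applied, \<open>residual_rows\<close> makes
  \<open>u\<close> orthogonal to the old span.\<close>

lemma rows_span_insert_orthogonal:
  assumes k: "k < dim_row F" and p: "p \<in> rows_span F I" and u: "u \<in> carrier_vec (dim_col F)"
    and row: "row F k = u + p"
  shows "y \<in> rows_span F (insert k I) \<longleftrightarrow> (\<exists>z\<in>rows_span F I. \<exists>t. y = z + t \<cdot>\<^sub>v u)"
proof
  assume "y \<in> rows_span F (insert k I)"
  then obtain y' t where y': "y' \<in> rows_span F I" and y: "y = y' + t \<cdot>\<^sub>v row F k"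
    using k by (rule rows_span_insertE)
  have "y = (y' + t \<cdot>\<^sub>v p) + t \<cdot>\<^sub>v u"
    unfolding y row using u rows_span_carrier[OF y'] rows_span_carrier[OF p]
    by (intro eq_vecI) (auto simp: algebra_simps)
  moreover have "y' + t \<cdot>\<^sub>v p \<in> rows_span F I"
    using y' p by (intro rows_span_add rows_span_smult)
  ultimately show "\<exists>z\<in>rows_span F I. \<exists>t. y = z + t \<cdot>\<^sub>v u"
    by blast
next
  assume "\<exists>z\<in>rows_span F I. \<exists>t. y = z + t \<cdot>\<^sub>v u"
  then obtain z t where z: "z \<in> rows_span F I" and y: "y = z + t \<cdot>\<^sub>v u"
    by blast
  have sub: "rows_span F I \<subseteq> rows_span F (insert k I)"
    by (rule rows_span_mono) auto
  have "y = z + (t \<cdot>\<^sub>v row F k + (- t) \<cdot>\<^sub>v p)"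
    unfolding y row using u rows_span_carrier[OF z] rows_span_carrier[OF p]
    by (intro eq_vecI) (auto simp: algebra_simps)
  then show "y \<in> rows_span F (insert k I)"
    using sub z p k by (auto intro!: rows_span_add rows_span_smult row_in_rows_span)
qed

subsection \<open>Orthogonal updates\<close>

lemma scalar_prod_self_pos:
  fixes u :: "real vec"
  assumes "u \<in> carrier_vec m" "u \<noteq> 0\<^sub>v m"
  shows "u \<bullet> u > 0"
proof -
  obtain j where "j < m" "u $ j \<noteq> 0"
    using assms by (metis carrier_vecD eq_vecI index_zero_vec)
  then have "0 < (\<Sum>i<m. u $ i * u $ i)"
    by (intro sum_pos2[of _ j]) (auto simp: zero_less_mult_iff linorder_neq_iff)
  then show ?thesis
    using assms by (auto simp: scalar_prod_def lessThan_atLeast0)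
qed

lemma norm2_power2: "(norm2 v)\<^sup>2 = v \<bullet> v"
  unfolding norm2_def by (rule real_sqrt_pow2) (auto simp: scalar_prod_def intro: sum_nonneg)

text \<open>By Pythagoras the mixed term vanishes, so the objective separates into a part in
  \<open>y\<close> and a quadratic in \<open>t\<close>, which can be minimized
  independently.\<close>

lemma row_objective_add_orthogonal:
  assumes "\<delta> \<in> carrier_vec m" "y \<in> carrier_vec m" "u \<in> carrier_vec m" "u \<bullet> y = 0"
  shows "row_objective \<delta> (y + t \<cdot>\<^sub>v u) = row_objective \<delta> y + (t * (\<delta> \<bullet> u) + t\<^sup>2 * (u \<bullet> u))"
proof -
  have "y \<bullet> u = 0"
    using assms comm_scalar_prod by metis
  then have "(y + t \<cdot>\<^sub>v u) \<bullet> (y + t \<cdot>\<^sub>v u) = y \<bullet> y + t\<^sup>2 * (u \<bullet> u)"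
    using assms by (simp add: add_scalar_prod_distrib[of _ m] scalar_prod_add_distrib[of _ m] power2_eq_square)
  moreover have "\<delta> \<bullet> (y + t \<cdot>\<^sub>v u) = \<delta> \<bullet> y + t * (\<delta> \<bullet> u)"
    using assms by (simp add: scalar_prod_add_distrib[of _ m])
  ultimately show ?thesis
    by (simp add: row_objective_def norm2_power2)
qed

text \<open>Completing the square: the difference of the two sides is
  \<open>(2 * q * t + a)\<^sup>2 / (4 * q)\<close>, which vanishes at the vertex.\<close>

lemma quadratic_lower_bound:
  fixes a q t :: real
  assumes "q > 0"
  shows "- (a\<^sup>2 / (4 * q)) \<le> t * a + t\<^sup>2 * q"
    and "t = - a / (2 * q) \<Longrightarrow> t * a + t\<^sup>2 * q = - (a\<^sup>2 / (4 * q))"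
proof -
  have "t * a + t\<^sup>2 * q + a\<^sup>2 / (4 * q) = (2 * q * t + a)\<^sup>2 / (4 * q)"
    using assms by (simp add: field_simps power2_eq_square)
  moreover have "(2 * q * t + a)\<^sup>2 / (4 * q) \<ge> 0"
    using assms by simp
  ultimately show "- (a\<^sup>2 / (4 * q)) \<le> t * a + t\<^sup>2 * q"
    by linarith
  show "t * a + t\<^sup>2 * q = - (a\<^sup>2 / (4 * q))" if "t = - a / (2 * q)"
    unfolding that using assms by (simp add: field_simps power2_eq_square)
qed

text \<open>Multiplication by the projection matrix from the right acts on each remaining row as one
  Gram-Schmidt step against \<open>u\<close>. The index shift comes from the deleted first
  row.\<close>

lemma row_next_matrix_update:
  assumes H: "H \<in> carrier_mat (Suc k) m" and u: "u = row H 0" "u \<noteq> 0\<^sub>v m" and i: "i < k"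
  shows "row (next_matrix H 1) i = row H (Suc i) + (- (row H (Suc i) \<bullet> u / (u \<bullet> u))) \<cdot>\<^sub>v u"
proof (rule eq_vecI)
  let ?h = "row H (Suc i)" and ?D = "delete_first_row H"
  let ?Q = "1\<^sub>m m - (1 / (norm2 u)\<^sup>2) \<cdot>\<^sub>m outer_prod u u"
  have N: "next_matrix H 1 = ?D * ?Q"
    using u H by (simp add: next_matrix_def Let_def)
  have um: "u \<in> carrier_vec m"
    using u(1) H by auto
  have Q: "?Q \<in> carrier_mat m m"
    using um by (auto simp: outer_prod_def)
  have D: "?D \<in> carrier_mat k m"
    using H by (auto simp: delete_first_row_def)
  have rowD: "row ?D i = ?h"
    using H i by (intro eq_vecI) (auto simp: delete_first_row_def)
  fix j assume "j < dim_vec (?h + (- (?h \<bullet> u / (u \<bullet> u))) \<cdot>\<^sub>v u)"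
  then have j: "j < m"
    using um by simp
  \<comment> \<open>By symmetry of the projection, its column \<open>j\<close> is the projected unit
    vector; pairing it with \<open>?h\<close> gives coordinate \<open>j\<close> of the projected
    row.\<close>
  have colQ: "col ?Q j = unit_vec m j + (- (u $ j / (u \<bullet> u))) \<cdot>\<^sub>v u"
    by (rule eq_vecI) (use um j in \<open>auto simp: outer_prod_def norm2_power2\<close>)
  have "row (next_matrix H 1) i $ j = ?h \<bullet> col ?Q j"
    unfolding N using D Q i j rowD by (auto simp: index_mult_mat)
  also have "\<dots> = ?h \<bullet> unit_vec m j + ?h \<bullet> ((- (u $ j / (u \<bullet> u))) \<cdot>\<^sub>v u)"
    unfolding colQ using H um i by (intro scalar_prod_add_distrib[of _ m]) auto
  also have "\<dots> = ?h $ j - ?h \<bullet> u / (u \<bullet> u) * u $ j"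
    using H um i j by (simp add: scalar_prod_right_unit)
  also have "\<dots> = (?h + (- (?h \<bullet> u / (u \<bullet> u))) \<cdot>\<^sub>v u) $ j"
    using H um i j by simp
  finally show "row (next_matrix H 1) i $ j = (?h + (- (?h \<bullet> u / (u \<bullet> u))) \<cdot>\<^sub>v u) $ j" .
next
  show "dim_vec (row (next_matrix H 1) i) = dim_vec (row H (Suc i) + (- (row H (Suc i) \<bullet> u / (u \<bullet> u))) \<cdot>\<^sub>v u)"
    using H u by (simp add: next_matrix_def Let_def outer_prod_def)
qed

lemma row_next_matrix_delete:
  assumes H: "H \<in> carrier_mat (Suc k) m" and "b \<noteq> 1 \<or> row H 0 = 0\<^sub>v m" and i: "i < k"
  shows "row (next_matrix H b) i = row H (Suc i)"
proof -
  have "next_matrix H b = delete_first_row H"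
    using assms by (auto simp: next_matrix_def Let_def)
  then show ?thesis
    using H i by (intro eq_vecI) (auto simp: delete_first_row_def)
qed

lemma next_matrix_carrier:
  assumes "H \<in> carrier_mat (Suc k) m"
  shows "next_matrix H b \<in> carrier_mat k m"
  using assms by (auto simp: next_matrix_def Let_def delete_first_row_def outer_prod_def)

text \<open>The rows of \<open>H\<close> are the rows \<open>k, k + 1, \<dots>\<close> of \<open>F\<close>, projected onto the orthogonal
  complement of the span of the rows in \<open>I\<close>.\<close>

definition residual_rows :: "real mat \<Rightarrow> nat \<Rightarrow> nat set \<Rightarrow> real mat \<Rightarrow> bool" where
  "residual_rows F k I H \<longleftrightarrow>
     k \<le> dim_row F \<and> H \<in> carrier_mat (dim_row F - k) (dim_col F) \<and>
     (\<forall>i<dim_row F - k. (\<exists>p\<in>rows_span F I. row F (k + i) = row H i + p) \<and>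
        (\<forall>y\<in>rows_span F I. row H i \<bullet> y = 0))"

lemma residual_rows_init: "residual_rows F 0 {} F"
  unfolding residual_rows_def rows_span_empty by auto

text \<open>Here the transition only drops the first row, so the decompositions of the other rows
  survive with the same \<open>I\<close> and shifted indices.\<close>

lemma residual_rows_skip:
  assumes R: "residual_rows F k I H" and k: "k < dim_row F"
    and b: "b \<noteq> 1 \<or> row H 0 = 0\<^sub>v (dim_col F)"
  shows "residual_rows F (Suc k) I (next_matrix H b)"
proof -
  have H: "H \<in> carrier_mat (Suc (dim_row F - Suc k)) (dim_col F)"
    using R k by (simp add: residual_rows_def Suc_diff_Suc)
  have "row (next_matrix H b) i = row H (Suc i)" if "i < dim_row F - Suc k" for i
    using row_next_matrix_delete[OF H b that] .
  moreover have "Suc i < dim_row F - k" if "i < dim_row F - Suc k" for i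
    using that by simp
  ultimately show ?thesis
    using R k next_matrix_carrier[OF H, of b] unfolding residual_rows_def
    by (metis Suc_leI add_Suc_shift)
qed

text \<open>This is the invariant behind the state matrix: the recursion performs Gram-Schmidt on
  the selected rows while keeping all later rows orthogonal to their span.\<close>

lemma residual_rows_step:
  assumes R: "residual_rows F k I H" and k: "k < dim_row F" and b: "b \<in> {0, 1}"
  shows "residual_rows F (Suc k) (if b = 1 then insert k I else I) (next_matrix H b)"
proof -
  define m where "m = dim_col F"
  define u where "u = row H 0"
  have H: "H \<in> carrier_mat (Suc (dim_row F - Suc k)) m"
    using R k by (simp add: residual_rows_def Suc_diff_Suc m_def)
  have u: "u \<in> carrier_vec m"
    unfolding u_def using H by auto
  obtain p where p: "p \<in> rows_span F I" "row F k = u + p"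
    using R k unfolding residual_rows_def u_def by (metis add_0_right zero_less_diff)
  have orth: "row H i \<bullet> y = 0" if "i < dim_row F - k" "y \<in> rows_span F I" for i y
    using R that unfolding residual_rows_def by blast
  note ins = rows_span_insert_orthogonal[OF k p(1) u[unfolded m_def] p(2)]
  have sub: "rows_span F I \<subseteq> rows_span F (insert k I)"
    by (rule rows_span_mono) auto
  consider "b = 0" | "b = 1" "u = 0\<^sub>v m" | "b = 1" "u \<noteq> 0\<^sub>v m"
    using b by auto
  then show ?thesis
  proof cases
    case 1
    then show ?thesis
      using residual_rows_skip[OF R k, of b] by simp
  next
    case 2
    \<comment> \<open>A zero residual means that row \<open>k\<close> equals \<open>p\<close> and so
      already lies in the span.\<close>
    have "rows_span F (insert k I) = rows_span F I"
    proof -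
      have "z + t \<cdot>\<^sub>v u = z" if "z \<in> rows_span F I" for z t
        using rows_span_carrier[OF that] 2 by (intro eq_vecI) (auto simp: m_def)
      then show ?thesis
        using ins by (metis subsetI subset_antisym sub)
    qed
    then show ?thesis
      using residual_rows_skip[OF R k, of b] 2 unfolding residual_rows_def
      by (simp add: u_def m_def)
  next
    case 3
    have "(\<exists>p\<in>rows_span F (insert k I). row F (Suc k + i) = row (next_matrix H b) i + p) \<and>
        (\<forall>y\<in>rows_span F (insert k I). row (next_matrix H b) i \<bullet> y = 0)"
      if i: "i < dim_row F - Suc k" for i
    proof -
      define h where "h = row H (Suc i)"
      define s where "s = h \<bullet> u / (u \<bullet> u)"
      have h: "h \<in> carrier_vec m"
        unfolding h_def using H i by auto
      have N: "row (next_matrix H b) i = h + (- s) \<cdot>\<^sub>v u"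
        using row_next_matrix_update[OF H u_def 3(2) i] 3(1) by (simp add: h_def s_def)
      have Si: "Suc i < dim_row F - k"
        using i by simp
      obtain p' where p': "p' \<in> rows_span F I" "row F (Suc k + i) = h + p'"
        using R Si unfolding residual_rows_def h_def by (metis add_Suc_shift)
      \<comment> \<open>The component \<open>s \<cdot>\<^sub>v u\<close> leaves the residual and
        joins the span part, which is legitimate since \<open>u\<close> lies in the enlarged
        span.\<close>
      have "row F (Suc k + i) = (h + (- s) \<cdot>\<^sub>v u) + (p' + s \<cdot>\<^sub>v u)"
        unfolding p'(2) using h u rows_span_carrier[OF p'(1)]
        by (intro eq_vecI) (auto simp: m_def)
      moreover have "p' + s \<cdot>\<^sub>v u \<in> rows_span F (insert k I)"
        using ins p'(1) by blast
      \<comment> \<open>For \<open>y = z + t \<cdot>\<^sub>v u\<close>, orthogonality to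
        \<open>z\<close> leaves \<open>t * (h \<bullet> u - s * (u \<bullet> u))\<close>, which is
        zero by the choice of \<open>s\<close>.\<close>
      moreover have "(h + (- s) \<cdot>\<^sub>v u) \<bullet> y = 0" if yS: "y \<in> rows_span F (insert k I)" for y
      proof -
        obtain z t where z: "z \<in> rows_span F I" and y: "y = z + t \<cdot>\<^sub>v u"
          using iffD1[OF ins yS] by blast
        have zm: "z \<in> carrier_vec m"
          using rows_span_carrier[OF z] by (simp add: m_def)
        have "h \<bullet> z = 0" "u \<bullet> z = 0"
          using orth z Si k unfolding h_def u_def by auto
        moreover have "u \<bullet> u > 0"
          using scalar_prod_self_pos[OF u 3(2)] .
        ultimately show ?thesis
          unfolding y using h u zm
          by (simp add: add_scalar_prod_distrib[of _ m] scalar_prod_add_distrib[of _ m] s_def)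
      qed
      ultimately show ?thesis
        unfolding N by blast
    qed
    then show ?thesis
      using next_matrix_carrier[OF H, of b] 3 k unfolding residual_rows_def by (simp add: m_def)
  qed
qed

text \<open>A minimizer is carried along instead of an infimum, so attainment follows by induction.
  The objective separates along \<open>u\<close>, hence the old minimizer only has to be moved by
  the optimal multiple of \<open>u\<close>.\<close>

lemma minimizer_step:
  assumes R: "residual_rows F k I H" and k: "k < dim_row F" and b: "b \<in> {0, 1}"
    and \<delta>: "\<delta> \<in> carrier_vec (dim_col F)"
    and y0: "y0 \<in> rows_span F I" "\<And>y. y \<in> rows_span F I \<Longrightarrow> row_objective \<delta> y0 \<le> row_objective \<delta> y"
  obtains y1 where "y1 \<in> rows_span F (if b = 1 then insert k I else I)"
    "\<And>y. y \<in> rows_span F (if b = 1 then insert k I else I) \<Longrightarrow> row_objective \<delta> y1 \<le> row_objective \<delta> y"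
    "row_objective \<delta> y1 = row_objective \<delta> y0 - 1 / 4 * (\<delta> \<bullet> transition_vec H b)\<^sup>2"
proof -
  define m where "m = dim_col F"
  define u where "u = row H 0"
  have H: "H \<in> carrier_mat (Suc (dim_row F - Suc k)) m"
    using R k by (simp add: residual_rows_def Suc_diff_Suc m_def)
  have u: "u \<in> carrier_vec m"
    unfolding u_def using H by auto
  obtain p where p: "p \<in> rows_span F I" "row F k = u + p"
    using R k unfolding residual_rows_def u_def by (metis add_0_right zero_less_diff)
  have orth: "u \<bullet> y = 0" if "y \<in> rows_span F I" for y
    using R k that unfolding residual_rows_def u_def by (meson zero_less_diff)
  note ins = rows_span_insert_orthogonal[OF k p(1) u[unfolded m_def] p(2)]
  have \<delta>m: "\<delta> \<in> carrier_vec m"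
    using \<delta> by (simp add: m_def)
  have obj: "row_objective \<delta> (z + t \<cdot>\<^sub>v u) = row_objective \<delta> z + (t * (\<delta> \<bullet> u) + t\<^sup>2 * (u \<bullet> u))"
    if "z \<in> rows_span F I" for z t
    using row_objective_add_orthogonal[OF \<delta>m _ u orth[OF that]] rows_span_carrier[OF that]
    by (simp add: m_def)
  show ?thesis
  proof (cases "b = 1 \<and> u \<noteq> 0\<^sub>v m")
    case True
    define q where "q = u \<bullet> u"
    \<comment> \<open>The vertex of
      \<open>t * (\<delta> \<bullet> u) + t\<^sup>2 * q\<close>.\<close>
    define t where "t = - (\<delta> \<bullet> u) / (2 * q)"
    have q: "q > 0"
      unfolding q_def using scalar_prod_self_pos u True by blast
    have "transition_vec H b = (1 / norm2 u) \<cdot>\<^sub>v u"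
      using True H by (simp add: transition_vec_def Let_def u_def)
    then have T: "(\<delta> \<bullet> transition_vec H b)\<^sup>2 = (\<delta> \<bullet> u)\<^sup>2 / q"
      using \<delta>m u by (simp add: power_divide norm2_power2 q_def)
    have val: "row_objective \<delta> (y0 + t \<cdot>\<^sub>v u) = row_objective \<delta> y0 - (\<delta> \<bullet> u)\<^sup>2 / (4 * q)"
      using obj[OF y0(1)] quadratic_lower_bound(2)[OF q t_def] by (simp add: q_def)
    show ?thesis
    proof (rule that)
      show "y0 + t \<cdot>\<^sub>v u \<in> rows_span F (if b = 1 then insert k I else I)"
        using ins y0(1) True by auto
      show "row_objective \<delta> (y0 + t \<cdot>\<^sub>v u) = row_objective \<delta> y0 - 1 / 4 * (\<delta> \<bullet> transition_vec H b)\<^sup>2"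
        unfolding val T by simp
      fix y assume "y \<in> rows_span F (if b = 1 then insert k I else I)"
      then obtain z s where z: "z \<in> rows_span F I" and y: "y = z + s \<cdot>\<^sub>v u"
        using ins True by auto
      show "row_objective \<delta> (y0 + t \<cdot>\<^sub>v u) \<le> row_objective \<delta> y"
        unfolding val y obj[OF z]
        using y0(2)[OF z] quadratic_lower_bound(1)[OF q, of "\<delta> \<bullet> u" s] by (simp add: q_def)
    qed
  next
    \<comment> \<open>Either the row is not selected or its residual is zero. In both cases the span
      does not grow and the transition vector is zero, so \<open>y0\<close> remains the
      minimizer.\<close>
    case False
    have "transition_vec H b = 0\<^sub>v m"
      using False H by (auto simp: transition_vec_def Let_def u_def)
    then have T: "\<delta> \<bullet> transition_vec H b = 0"
      using \<delta>m by simp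
    have "y \<in> rows_span F I" if y: "y \<in> rows_span F (if b = 1 then insert k I else I)" for y
    proof (cases "b = 1")
      case True
      then obtain z t where z: "z \<in> rows_span F I" and "y = z + t \<cdot>\<^sub>v u"
        using y ins by auto
      moreover have "u = 0\<^sub>v m"
        using False True by simp
      ultimately have "y = z"
        using rows_span_carrier[OF z] by (auto simp: m_def)
      then show ?thesis
        using z by simp
    qed (use y in simp)
    moreover have "y0 \<in> rows_span F (if b = 1 then insert k I else I)"
      using y0(1) rows_span_mono[of I "insert k I" F] by auto
    ultimately show ?thesis
      using that[of y0] y0(2) T by auto
  qed
qed

subsection \<open>Paths and partial solutions\<close>

definition support :: "real vec \<Rightarrow> nat set" where
  "support v = {i. i < dim_vec v \<and> v $ i = 1}"

lemma Row_selected_rows: "dim_vec v = l - 1 \<Longrightarrow> Row (selected_rows F l v) = rows_span F (support v)"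
  by (simp add: selected_rows_def Row_submatrix support_def)

lemma dim_append_decision: "dim_vec (append_decision v b) = Suc (dim_vec v)"
  by (simp add: append_decision_def)

lemma index_append_decision:
  "i \<le> dim_vec v \<Longrightarrow> append_decision v b $ i = (if i < dim_vec v then v $ i else b)"
  by (auto simp: append_decision_def)

lemma support_append_decision:
  "support (append_decision v b) = (if b = 1 then insert (dim_vec v) (support v) else support v)"
  by (auto simp: support_def dim_append_decision index_append_decision less_Suc_eq_le split: if_splits)

lemma append_decision_in_bin_vecs:
  assumes "v \<in> bin_vecs k" "b \<in> {0, 1}"
  shows "append_decision v b \<in> bin_vecs (Suc k)"
proof -
  have "append_decision v b $ i \<in> {0, 1}" if "i < Suc k" for i
    using assms that by (cases "i < k") (auto simp: bin_vecs_def index_append_decision)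
  moreover have "append_decision v b \<in> carrier_vec (Suc k)"
    using assms(1) by (intro carrier_vecI) (simp add: bin_vecs_def dim_append_decision)
  ultimately show ?thesis
    by (simp add: bin_vecs_def)
qed

lemma append_decision_append: "append_decision v b @\<^sub>v w = v @\<^sub>v vCons b w"
proof (rule eq_vecI)
  fix i assume "i < dim_vec (v @\<^sub>v vCons b w)"
  then have i: "i < dim_vec v + Suc (dim_vec w)"
    by simp
  consider "i < dim_vec v" | "i = dim_vec v" | j where "i = dim_vec v + Suc j"
    by (metis add_Suc_right less_iff_Suc_add linorder_neqE_nat)
  then show "(append_decision v b @\<^sub>v w) $ i = (v @\<^sub>v vCons b w) $ i"
    by cases (use i in \<open>auto simp: dim_append_decision index_append_decision\<close>)
qed (simp add: dim_append_decision)

lemma vCons_in_bin_vecs: "vCons b w \<in> bin_vecs (Suc k) \<longleftrightarrow> b \<in> {0, 1} \<and> w \<in> bin_vecs k"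
proof -
  have "(\<forall>i<Suc k. vCons b w $ i \<in> {0, 1}) \<longleftrightarrow> b \<in> {0, 1} \<and> (\<forall>i<k. w $ i \<in> {0, 1})"
    unfolding All_less_Suc2 vec_index_vCons_0 vec_index_vCons_Suc ..
  moreover have "vCons b w \<in> carrier_vec (Suc k) \<longleftrightarrow> w \<in> carrier_vec k"
    by simp
  ultimately show ?thesis
    unfolding bin_vecs_def by blast
qed

text \<open>Moving the decision from the end of the prefix to the front of the completion does not
  change the concatenation. So the completions of \<open>v\<close> determine those of its
  extensions.\<close>

lemma completions_append_decision:
  assumes "l \<le> n" "b \<in> {0, 1}"
  shows "w \<in> completions n Z (Suc l) (append_decision v b) \<longleftrightarrow> vCons b w \<in> completions n Z l v"
  using assms vCons_in_bin_vecs[of b w "n - l"]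
  by (simp add: completions_def append_decision_append Suc_diff_le)

lemma path_vec_Nil: "path_vec [] = vNil"
  by (simp add: path_vec_def)

lemma path_vec_snoc: "path_vec (as @ [a]) = append_decision (path_vec as) (arc_value a)"
  by (induction as) (auto simp: path_vec_def append_decision_def simp del: vec_of_list_map)

lemma dim_path_vec: "dim_vec (path_vec as) = length as"
  by (simp add: path_vec_def)

lemma path_length_snoc: "path_length c \<delta> (as @ [a]) = path_length c \<delta> as + arc_length c \<delta> a"
  by (simp add: path_length_def)

section \<open>Paths from the root: lengths, states and existence\<close>

lemma dd_path_snoc:
  "dd_path A s (as @ [a]) t \<longleftrightarrow> dd_path A s as (arc_tail a) \<and> a \<in> A \<and> arc_head a = t"
  by (induction as arbitrary: s) auto

lemma dd_path_snocE:
  assumes "dd_path (dd_arcs n Z \<rho> \<psi> F) s (as @ [a]) t"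
  obtains l r H b where "dd_path (dd_arcs n Z \<rho> \<psi> F) s as (l, r, H)" "l \<le> n"
    "(l, r, H) \<in> dd_nodes n Z \<rho> \<psi> F" "feasible_decision n Z \<rho> l r b"
    "a = dd_arc \<psi> (l, r, H) b" "t = (Suc l, \<psi> r b, next_matrix H b)"
  using assms unfolding dd_path_snoc dd_arcs_def by auto

text \<open>The last arc suffices: its tail is a node by definition of \<open>dd_arcs\<close>, and
  the \<open>step\<close> rule then yields its head.\<close>

lemma root_path_end_in_nodes:
  assumes "dd_path (dd_arcs n Z \<rho> \<psi> F) (dd_root \<rho> F) as t"
  shows "t \<in> dd_nodes n Z \<rho> \<psi> F"
proof (cases as rule: rev_cases)
  case Nil
  then show ?thesis
    using assms by (auto intro: dd_nodes.root)
next
  case (snoc bs a)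
  obtain l r H b where "(l, r, H) \<in> dd_nodes n Z \<rho> \<psi> F" "l \<le> n" "feasible_decision n Z \<rho> l r b"
    and t: "t = (Suc l, \<psi> r b, next_matrix H b)"
    using assms unfolding snoc by (rule dd_path_snocE)
  from dd_nodes.step[OF this(1-3)] show ?thesis
    by (simp add: t)
qed

text \<open>One induction carries the layer count, the residual invariant and a minimizer together,
  because the length of the next arc depends on the state matrix and is compared with the minimum so
  far.\<close>

lemma root_path_value:
  assumes F: "F \<in> carrier_mat n m" and \<delta>: "\<delta> \<in> carrier_vec m"
    and "dd_path (dd_arcs n Z \<rho> \<psi> F) (dd_root \<rho> F) as t"
  shows "fst t = Suc (length as) \<and> length as \<le> n \<and> path_vec as \<in> bin_vecs (length as) \<and>
    residual_rows F (length as) (support (path_vec as)) (snd (snd t)) \<and>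
    (\<exists>y0\<in>rows_span F (support (path_vec as)).
       (\<forall>y\<in>rows_span F (support (path_vec as)). row_objective \<delta> y0 \<le> row_objective \<delta> y) \<and>
       path_length c \<delta> as = (\<Sum>i<length as. c $ i * path_vec as $ i) + row_objective \<delta> y0)"
  using assms(3)
proof (induction as arbitrary: t rule: rev_induct)
  case Nil
  have "support (path_vec []) = {}"
    by (simp add: support_def dim_path_vec)
  moreover have "row_objective \<delta> (0\<^sub>v m) = 0"
    using \<delta> by (simp add: row_objective_def norm2_power2)
  ultimately show ?case
    using Nil F residual_rows_init[of F]
    by (auto simp: dd_root_def rows_span_empty path_length_def bin_vecs_def path_vec_Nil)
next
  case (snoc a as)
  define v where "v = path_vec as"
  obtain l r H b where path: "dd_path (dd_arcs n Z \<rho> \<psi> F) (dd_root \<rho> F) as (l, r, H)"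
    and l: "l \<le> n" and feas: "feasible_decision n Z \<rho> l r b"
    and a: "a = dd_arc \<psi> (l, r, H) b" and t: "t = (Suc l, \<psi> r b, next_matrix H b)"
    using snoc.prems by (rule dd_path_snocE)
  have b: "b \<in> {0, 1}"
    using feas by (simp add: feasible_decision_def)
  define I where "I = support v"
  obtain y0 where lk: "l = Suc (length as)" and v: "v \<in> bin_vecs (length as)"
    and R: "residual_rows F (length as) I H" and y0: "y0 \<in> rows_span F I"
      "\<And>y. y \<in> rows_span F I \<Longrightarrow> row_objective \<delta> y0 \<le> row_objective \<delta> y"
    and len: "path_length c \<delta> as = (\<Sum>i<length as. c $ i * v $ i) + row_objective \<delta> y0"
    using snoc.IH[OF path] unfolding v_def I_def by auto
  have dimv: "dim_vec v = length as"
    by (simp add: v_def dim_path_vec)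
  have k: "length as < dim_row F"
    using l lk F by simp
  have \<delta>': "\<delta> \<in> carrier_vec (dim_col F)"
    using F \<delta> by simp
  have pv: "path_vec (as @ [a]) = append_decision v b"
    by (simp add: path_vec_snoc v_def a)
  have supp: "support (path_vec (as @ [a])) = (if b = 1 then insert (length as) I else I)"
    unfolding pv support_append_decision I_def dimv by simp
  obtain y1 where y1: "y1 \<in> rows_span F (support (path_vec (as @ [a])))"
      "\<And>y. y \<in> rows_span F (support (path_vec (as @ [a]))) \<Longrightarrow>
         row_objective \<delta> y1 \<le> row_objective \<delta> y"
      "row_objective \<delta> y1 = row_objective \<delta> y0 - 1 / 4 * (\<delta> \<bullet> transition_vec H b)\<^sup>2"
    unfolding supp using minimizer_step[OF R k b \<delta>' y0] by blast
  have "(\<Sum>i<length as. c $ i * append_decision v b $ i) = (\<Sum>i<length as. c $ i * v $ i)"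
    by (rule sum.cong) (auto simp: index_append_decision dimv)
  \<comment> \<open>The new arc leaves layer \<open>Suc (length as)\<close>, so its cost coefficient
    has index \<open>length as\<close>, the position of the appended decision.\<close>
  then have "path_length c \<delta> (as @ [a])
      = (\<Sum>i<length (as @ [a]). c $ i * path_vec (as @ [a]) $ i) + row_objective \<delta> y1"
    unfolding path_length_snoc len y1(3) pv
    by (simp add: a arc_length_def arc_layer_def lk index_append_decision dimv)
  moreover have "residual_rows F (length (as @ [a])) (support (path_vec (as @ [a]))) (snd (snd t))"
    unfolding supp t using residual_rows_step[OF R k b] by simp
  moreover have "path_vec (as @ [a]) \<in> bin_vecs (length (as @ [a]))"
    unfolding pv using append_decision_in_bin_vecs[OF v b] by simp
  moreover have "fst t = Suc (length (as @ [a]))" "length (as @ [a]) \<le> n"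
    using t lk l by auto
  ultimately show ?case
    using y1(1,2) by blast
qed

lemma partial_value_eq_minimum:
  assumes "dim_vec v = l - 1" "y0 \<in> rows_span F (support v)"
    and "\<And>y. y \<in> rows_span F (support v) \<Longrightarrow> row_objective \<delta> y0 \<le> row_objective \<delta> y"
  shows "partial_value F c \<delta> l v = (\<Sum>i<l - 1. c $ i * v $ i) + row_objective \<delta> y0"
proof -
  have "(INF y\<in>rows_span F (support v). row_objective \<delta> y) = row_objective \<delta> y0"
    by (rule cInf_eq_minimum) (use assms in auto)
  then show ?thesis
    using assms(1) by (simp add: partial_value_def Row_selected_rows)
qed

text \<open>Feasibility of a decision is witnessed by some partial solution with the same state, not by
  the path itself; equality of the completion sets transfers the witness to the path.\<close>

lemma root_path_partial_sol:
  assumes dp: "dp_representation n Z \<rho> \<psi>" and Z: "Z \<subseteq> bin_vecs n" "Z \<noteq> {}"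
    and F: "F \<in> carrier_mat n m"
    and "dd_path (dd_arcs n Z \<rho> \<psi> F) (dd_root \<rho> F) as t"
  shows "path_vec as \<in> partial_sols n Z (Suc (length as)) \<and>
    fst (snd t) = \<rho> (Suc (length as)) (path_vec as)"
  using assms(5)
proof (induction as arbitrary: t rule: rev_induct)
  case Nil
  have "completions n Z (Suc 0) vNil = Z"
    using Z(1) by (auto simp: completions_def)
  then show ?case
    using Nil Z(2) by (auto simp: partial_sols_def bin_vecs_def path_vec_Nil dd_root_def)
next
  case (snoc a as)
  define v where "v = path_vec as"
  obtain l r H b where path: "dd_path (dd_arcs n Z \<rho> \<psi> F) (dd_root \<rho> F) as (l, r, H)"
    and l: "l \<le> n" and feas: "feasible_decision n Z \<rho> l r b"
    and a: "a = dd_arc \<psi> (l, r, H) b" and t: "t = (Suc l, \<psi> r b, next_matrix H b)"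
    using snoc.prems by (rule dd_path_snocE)
  \<comment> \<open>Only the layer count is wanted, so \<open>root_path_value\<close> is
    instantiated with the zero vector for \<open>\<delta>\<close>.\<close>
  have lk: "l = Suc (length as)"
    using root_path_value[OF F zero_carrier_vec path] by simp
  have v: "v \<in> partial_sols n Z l" and r: "r = \<rho> l v"
    using snoc.IH[OF path] by (simp_all add: v_def lk)
  obtain v' w where b: "b \<in> {0, 1}" and v': "v' \<in> partial_sols n Z l" "\<rho> l v' = r"
    and w: "w \<in> completions n Z (Suc l) (append_decision v' b)"
    using feas unfolding feasible_decision_def by auto
  have ln: "l \<in> {1..n}" "l \<in> {1..n + 1}"
    using l lk by auto
  have "completions n Z l v' = completions n Z l v"
    using dp v v' r ln unfolding dp_representation_def by blast
  then have "w \<in> completions n Z (Suc l) (append_decision v b)"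
    using w completions_append_decision[OF l b] by metis
  then have ps: "append_decision v b \<in> partial_sols n Z (Suc l)"
    using v append_decision_in_bin_vecs[of v "length as" b] b lk by (auto simp: partial_sols_def)
  moreover have "\<rho> (Suc l) (append_decision v b) = \<psi> (\<rho> l v) b"
    using dp v b ln ps unfolding dp_representation_def Suc_eq_plus1 by blast
  ultimately show ?case
    by (simp add: path_vec_snoc a t v_def[symmetric] r lk)
qed

text \<open>The path follows the entries of \<open>z\<close>. After each prefix the remaining
  entries of \<open>z\<close> are a completion, so the next decision is feasible and its arc
  exists.\<close>

lemma root_path_exists:
  assumes dp: "dp_representation n Z \<rho> \<psi>" and Z: "Z \<subseteq> bin_vecs n"
    and F: "F \<in> carrier_mat n m" and z: "z \<in> Z"
  shows "k \<le> n \<Longrightarrow> \<exists>as t. dd_path (dd_arcs n Z \<rho> \<psi> F) (dd_root \<rho> F) as t \<and>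
    path_vec as = vec_first z k"
proof (induction k)
  case 0
  have "path_vec [] = vec_first z 0"
    by (intro eq_vecI) (simp_all add: dim_path_vec)
  moreover have "dd_path (dd_arcs n Z \<rho> \<psi> F) (dd_root \<rho> F) [] (dd_root \<rho> F)"
    by simp
  ultimately show ?case
    by blast
next
  case (Suc k)
  define v where "v = vec_first z k"
  define b where "b = z $ k"
  obtain as l r H where path: "dd_path (dd_arcs n Z \<rho> \<psi> F) (dd_root \<rho> F) as (l, r, H)"
    and v: "path_vec as = v"
    using Suc v_def by (auto simp: Suc_le_eq)
  have len: "length as = k"
    using dim_path_vec[of as] by (simp add: v v_def)
  have Zne: "Z \<noteq> {}"
    using z by auto
  have l: "l = Suc k"
    using root_path_value[OF F zero_carrier_vec path] len by simp
  \<comment> \<open>The state reached is that of \<open>v\<close> itself, so \<open>v\<close> can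
    witness feasibility of the next decision.\<close>
  have ps: "v \<in> partial_sols n Z l" and r: "r = \<rho> l v"
    using root_path_partial_sol[OF dp Z Zne F path] by (simp_all add: v len l)
  have zb: "z \<in> bin_vecs n"
    using z Z by auto
  then have b: "b \<in> {0, 1}"
    using Suc.prems by (auto simp: bin_vecs_def b_def)
  have app: "append_decision v b = vec_first z (Suc k)"
    by (rule eq_vecI)
      (auto simp: v_def b_def vec_first_def dim_append_decision index_append_decision less_Suc_eq)
  have zn: "z \<in> carrier_vec (Suc k + (n - Suc k))" and z01: "\<And>i. i < n \<Longrightarrow> z $ i \<in> {0, 1}"
    using zb Suc.prems by (auto simp: bin_vecs_def)
  have "vec_last z (n - Suc k) \<in> bin_vecs (n - Suc k)"
    using zn Suc.prems z01 by (simp add: bin_vecs_def vec_last_def)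
  then have "vec_last z (n - Suc k) \<in> completions n Z (Suc l) (append_decision v b)"
    unfolding app using z vec_first_last_append[OF zn] by (simp add: completions_def l)
  then have feas: "feasible_decision n Z \<rho> l r b"
    using b ps r unfolding feasible_decision_def by auto
  have "dd_arc \<psi> (l, r, H) b \<in> dd_arcs n Z \<rho> \<psi> F"
    using root_path_end_in_nodes[OF path] feas Suc.prems unfolding dd_arcs_def l by blast
  then have "dd_path (dd_arcs n Z \<rho> \<psi> F) (dd_root \<rho> F) (as @ [dd_arc \<psi> (l, r, H) b])
      (arc_head (dd_arc \<psi> (l, r, H) b))"
    using path by (simp add: dd_path_snoc)
  moreover have "path_vec (as @ [dd_arc \<psi> (l, r, H) b]) = vec_first z (Suc k)"
    by (simp add: path_vec_snoc v app)
  ultimately show ?case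
    by blast
qed

section \<open>The problem in terms of row spaces, and the result\<close>

lemma objective_eq_row_objective:
  assumes F: "F \<in> carrier_mat n m" and \<delta>: "\<delta> \<in> carrier_vec m" "F *\<^sub>v \<delta> = d"
    and x: "x \<in> carrier_vec n" and z: "z \<in> carrier_vec n"
  shows "objective F c d (x, z) = (\<Sum>i<n. c $ i * z $ i) + row_objective \<delta> (F\<^sup>T *\<^sub>v x)"
proof -
  have "d \<bullet> x = x \<bullet> (F *\<^sub>v \<delta>)"
    unfolding \<delta>(2)[symmetric] using F \<delta> x by (intro comm_scalar_prod[of _ n]) auto
  also have "\<dots> = (F\<^sup>T *\<^sub>v x) \<bullet> \<delta>"
    using transpose_vec_mult_scalar[OF F \<delta>(1) x] by simp
  also have "\<dots> = \<delta> \<bullet> (F\<^sup>T *\<^sub>v x)"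
    using F \<delta> x by (intro comm_scalar_prod[of _ m]) auto
  finally show ?thesis
    using z by (simp add: objective_def row_objective_def scalar_prod_def[of c] lessThan_atLeast0)
qed

text \<open>For binary \<open>z\<close>, the factor \<open>1 - z $ i\<close> vanishes exactly on the
  support. The complementarity constraint thus becomes the condition on coefficient vectors in
  \<open>rows_span\<close>.\<close>

lemma feasible_set_iff:
  assumes "z \<in> bin_vecs n"
  shows "(x, z) \<in> feasible_set n Z \<longleftrightarrow>
    z \<in> Z \<and> x \<in> carrier_vec n \<and> (\<forall>i<n. i \<notin> support z \<longrightarrow> x $ i = 0)"
proof -
  have z: "dim_vec z = n" "\<And>i. i < n \<Longrightarrow> z $ i \<in> {0, 1}"
    using assms by (auto simp: bin_vecs_def)
  have "x \<circ>\<^sub>v (ones_vec n - z) = 0\<^sub>v n \<longleftrightarrow> (\<forall>i<n. x $ i * (1 - z $ i) = 0)"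
    if "x \<in> carrier_vec n"
    using that z by (auto simp: vec_eq_iff hadamard_def ones_vec_def)
  then show ?thesis
    using z by (auto simp: feasible_set_def support_def)
qed

theorem proposition6:
  fixes n m :: nat
    and F :: "real mat"
    and Z :: "real vec set"
    and \<rho> :: "nat \<Rightarrow> real vec \<Rightarrow> 's"
    and \<psi> :: "'s \<Rightarrow> real \<Rightarrow> 's"
    and c d \<delta> :: "real vec"
  assumes "n \<ge> 1"
    and "F \<in> carrier_mat n m"
    and "Z \<subseteq> bin_vecs n"
    and "dp_representation n Z \<rho> \<psi>"
    and "\<forall>c'\<in>carrier_vec n. \<forall>d'\<in>carrier_vec n.
           \<not> unbounded_problem n F Z c' d' \<longleftrightarrow> (\<exists>\<delta>'\<in>carrier_vec m. F *\<^sub>v \<delta>' = d')"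
    and "c \<in> carrier_vec n"
    and "d \<in> carrier_vec n"
    and "\<not> unbounded_problem n F Z c d"
    and "\<delta> \<in> carrier_vec m"
    and "F *\<^sub>v \<delta> = d"
  shows "(\<forall>l as t. l \<ge> 1 \<and> length as = l - 1 \<and> dd_path (dd_arcs n Z \<rho> \<psi> F) (dd_root \<rho> F) as t \<longrightarrow>
            path_vec as \<in> bin_vecs (l - 1) \<and>
            (\<exists>y. is_arg_min (row_objective \<delta>)
                   (\<lambda>y. y \<in> Row (selected_rows F l (path_vec as))) y) \<and>
            path_length c \<delta> as = partial_value F c \<delta> l (path_vec as))
       \<and> (\<forall>as. shortest_root_path n Z \<rho> \<psi> F c \<delta> as \<longrightarrow>
            length as = n \<and>
            (\<exists>x. optimal_solution n F Z c d (x, path_vec as)))"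
proof (intro conjI allI impI; (elim conjE)?)
  note F = assms(2) and \<delta> = assms(9)
  fix l as t
  assume l: "l \<ge> 1" "length as = l - 1" "dd_path (dd_arcs n Z \<rho> \<psi> F) (dd_root \<rho> F) as t"
  note val = root_path_value[OF F \<delta> l(3), of c]
  obtain y0 where y0: "y0 \<in> rows_span F (support (path_vec as))"
      "\<And>y. y \<in> rows_span F (support (path_vec as)) \<Longrightarrow> row_objective \<delta> y0 \<le> row_objective \<delta> y"
    and len: "path_length c \<delta> as = (\<Sum>i<length as. c $ i * path_vec as $ i) + row_objective \<delta> y0"
    using val by blast
  have dim: "dim_vec (path_vec as) = l - 1"
    by (simp add: dim_path_vec l)
  show "path_vec as \<in> bin_vecs (l - 1)"
    using val by (simp add: l)
  have "is_arg_min (row_objective \<delta>) (\<lambda>y. y \<in> Row (selected_rows F l (path_vec as))) y0"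
    using y0 by (auto simp: is_arg_min_def Row_selected_rows[OF dim] not_less)
  then show "\<exists>y. is_arg_min (row_objective \<delta>) (\<lambda>y. y \<in> Row (selected_rows F l (path_vec as))) y"
    by blast
  show "path_length c \<delta> as = partial_value F c \<delta> l (path_vec as)"
    using partial_value_eq_minimum[OF dim y0] len by (simp add: l)
next
  note F = assms(2) and \<delta> = assms(9,10)
  fix as
  assume short: "shortest_root_path n Z \<rho> \<psi> F c \<delta> as"
  let ?A = "dd_arcs n Z \<rho> \<psi> F" and ?s = "dd_root \<rho> F"
  obtain t where t: "fst t = n + 1" and path: "dd_path ?A ?s as t"
    using short unfolding shortest_root_path_def is_arg_min_def by blast
  have least: "path_length c \<delta> as \<le> path_length c \<delta> bs"
    if "dd_path ?A ?s bs t'" "fst t' = n + 1" for bs t'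
    using short that root_path_end_in_nodes[OF that(1)]
    unfolding shortest_root_path_def is_arg_min_def by (meson not_less)
  note val = root_path_value[OF F \<delta>(1) path, of c]
  show len: "length as = n"
    using val t by simp
  define z where "z = path_vec as"
  have zb: "z \<in> bin_vecs n"
    using val by (simp add: z_def len)
  obtain y0 where y0: "y0 \<in> rows_span F (support z)"
    and lz: "path_length c \<delta> as = (\<Sum>i<n. c $ i * z $ i) + row_objective \<delta> y0"
    using val unfolding z_def len by blast
  \<comment> \<open>The coefficient vector of the minimizer: it vanishes off the support of
    \<open>z\<close>, and its objective value is the path length.\<close>
  obtain x where x: "y0 = F\<^sup>T *\<^sub>v x" "x \<in> carrier_vec n"
      "\<And>i. i < n \<Longrightarrow> i \<notin> support z \<Longrightarrow> x $ i = 0"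
    using rows_spanE[OF y0] F by (metis carrier_matD(1))
  \<comment> \<open>The root is a node even for empty \<open>Z\<close>, but then there are no arcs,
    whereas this path has \<open>n \<ge> 1\<close> of them.\<close>
  have "Z \<noteq> {}"
  proof
    assume "Z = {}"
    then have "?A = {}"
      by (auto simp: dd_arcs_def feasible_decision_def completions_def)
    moreover have "as \<noteq> []"
      using len assms(1) by auto
    ultimately show False
      using path by (cases as) auto
  qed
  then have "z \<in> partial_sols n Z (Suc n)"
    using root_path_partial_sol[OF assms(4,3) _ F path] by (simp add: z_def len)
  \<comment> \<open>In layer \<open>n + 1\<close> a completion has length zero, so \<open>z\<close>
    itself belongs to \<open>Z\<close>.\<close>
  then obtain w where w: "w \<in> bin_vecs 0" "z @\<^sub>v w \<in> Z"
    by (auto simp: partial_sols_def completions_def)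
  have "z @\<^sub>v w = z"
    by (rule eq_vecI) (use w(1) in \<open>auto simp: bin_vecs_def\<close>)
  then have zZ: "z \<in> Z"
    using w(2) by simp
  \<comment> \<open>The path \<open>bs\<close> spelling \<open>z'\<close> links the two values:
    \<open>as\<close> is no longer than \<open>bs\<close>, and the length of \<open>bs\<close> is a
    minimum over a row space that contains the image of \<open>x'\<close>.\<close>
  have "objective F c d (x, z) \<le> objective F c d q" if q: "q \<in> feasible_set n Z" for q
  proof -
    obtain x' z' where q_eq: "q = (x', z')"
      by (cases q)
    have z': "z' \<in> Z" "z' \<in> bin_vecs n"
      using q assms(3) by (auto simp: q_eq feasible_set_def)
    then have z'c: "z' \<in> carrier_vec n"
      by (simp add: bin_vecs_def)
    have x': "x' \<in> carrier_vec n" "\<And>i. i < n \<Longrightarrow> i \<notin> support z' \<Longrightarrow> x' $ i = 0"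
      using q feasible_set_iff[OF z'(2)] by (auto simp: q_eq)
    obtain bs t' where bs: "dd_path ?A ?s bs t'" "path_vec bs = vec_first z' n"
      using root_path_exists[OF assms(4,3) F z'(1)] by blast
    have bs_z': "path_vec bs = z'"
      unfolding bs(2) using z'c by (intro eq_vecI) (auto simp: vec_first_def)
    have lbs: "length bs = n"
      using dim_path_vec[of bs] z'c by (simp add: bs_z')
    note val' = root_path_value[OF F \<delta>(1) bs(1), of c]
    have "F\<^sup>T *\<^sub>v x' \<in> rows_span F (support z')"
      using x' F by (intro rows_spanI) auto
    then have "path_length c \<delta> bs \<le> (\<Sum>i<n. c $ i * z' $ i) + row_objective \<delta> (F\<^sup>T *\<^sub>v x')"
      using val' unfolding bs_z' lbs by force
    also have "\<dots> = objective F c d q"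
      unfolding q_eq using objective_eq_row_objective[OF F \<delta> x'(1) z'c] by simp
    finally have "path_length c \<delta> bs \<le> objective F c d q" .
    moreover have "path_length c \<delta> as \<le> path_length c \<delta> bs"
      using least[OF bs(1)] val' lbs by simp
    moreover have "objective F c d (x, z) = path_length c \<delta> as"
      unfolding lz x(1) using zb
      by (intro objective_eq_row_objective[OF F \<delta> x(2)]) (simp add: bin_vecs_def)
    ultimately show ?thesis
      by simp
  qed
  moreover have "(x, z) \<in> feasible_set n Z"
    using feasible_set_iff[OF zb] zZ x by auto
  ultimately show "\<exists>x. optimal_solution n F Z c d (x, path_vec as)"
    unfolding optimal_solution_def is_arg_min_def z_def by (meson not_less)
qed

end
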